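(* Let $m,n$ be positive integers, $A=\{(i,j)\in\mathbb{Z}^2: 0\le i<m,\ 0\le j<n\}$, let $S=\{(a_d,b_d)\}_{d=1}^k$ be a valid set of directions for $A$, $M=\sum_{d=1}^k a_d$, $N=\sum_{d=1}^k|b_d|$. Let $h:A\to\mathbb{R}$ have integer line sums along all lines with directions in $S$. Then there exists a function $f:A\to\mathbb{Z}$ with the same line sums as $h$ along all lines with directions in $S$ such that $$|\vec f-\vec h|\le\frac12\sqrt{R(S)(m-M)(n-N)}.$$
   Context: A direction is a pair $(a,b)\in\mathbb{Z}^2$ with $\gcd(a,b)=1$ and $a\ge 0$, where $(a,b)=(0,1)$ if $a=0$. The lines with direction $(a,b)$ are the lines $ay=bx+t$ ($t\in\mathbb{Z}$); the line sum of $g:A\to\mathbb{R}$ along $ay=bx+t$ is $\sum g(i,j)$ over all $(i,j)\in A$ with $aj=bi+t$. A finite set $S$ of distinct directions is valid for $A$ if $\sum_d a_d<m$ and $\sum_d|b_d|<n$. For a direction $(a,b)$ put $f_{(a,b)}(x,y)=x^ay^b-1$ if $a>0,b>0$; $f_{(a,b)}(x,y)=x^a-y^{-b}$ if $a>0,b<0$; $f_{(1,0)}=x-1$; $f_{(0,1)}=y-1$. Let $F_S(x,y)=\prod_{d=1}^k f_{(a_d,b_d)}(x,y)$ and let $R(S)$ be the sum of the squares of all coefficients of the polynomial $F_S$. Functions $A\to\mathbb{R}$ are identified with vectors in $\mathbb{R}^{mn}$ with Euclidean norm $|\vec v|=\sqrt{\sum_{(i,j)\in A}v(i,j)^2}$.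 *)

theory Defs
  imports "HOL-Analysis.L2_Norm" "HOL-Computational_Algebra.Polynomial"
begin

text \<open>Functions \<open>g : A \<rightarrow> \<real>\<close> are rendered as total functions on \<open>\<int> \<times> \<int>\<close>;
  only their values on the grid are ever used.\<close>

definition grid :: "nat \<Rightarrow> nat \<Rightarrow> (int \<times> int) set" where
  "grid m n = {(i, j). 0 \<le> i \<and> i < int m \<and> 0 \<le> j \<and> j < int n}"

definition is_direction :: "int \<times> int \<Rightarrow> bool" where
  "is_direction = (\<lambda>(a, b). gcd a b = 1 \<and> a \<ge> 0 \<and> (a = 0 \<longrightarrow> (a, b) = (0, 1)))"

definition line_sum ::
    "(int \<times> int) set \<Rightarrow> (int \<times> int \<Rightarrow> real) \<Rightarrow> int \<times> int \<Rightarrow> int \<Rightarrow> real" where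
  "line_sum A g = (\<lambda>(a, b) t. \<Sum>(i, j) \<in> {(i, j). (i, j) \<in> A \<and> a * j = b * i + t}. g (i, j))"

definition width :: "(int \<times> int) set \<Rightarrow> int" where
  "width S = (\<Sum>(a, b)\<in>S. a)"

definition height :: "(int \<times> int) set \<Rightarrow> int" where
  "height S = (\<Sum>(a, b)\<in>S. \<bar>b\<bar>)"

definition valid_directions :: "nat \<Rightarrow> nat \<Rightarrow> (int \<times> int) set \<Rightarrow> bool" where
  "valid_directions m n S \<longleftrightarrow>
     finite S \<and> (\<forall>d\<in>S. is_direction d) \<and> width S < int m \<and> height S < int n"

text \<open>Polynomials in \<open>x, y\<close> are elements of \<open>\<int>[x][y]\<close>: the outer variable is \<open>y\<close>, so
  the coefficient of \<open>x\<^sup>i y\<^sup>j\<close> in \<open>p\<close> is \<open>coeff (coeff p j) i\<close>.\<close>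

definition xy_monom :: "nat \<Rightarrow> nat \<Rightarrow> int poly poly" where
  "xy_monom i j = monom (monom 1 i) j"

text \<open>On directions, the last two cases are exactly \<open>(1, 0)\<close> and \<open>(0, 1)\<close>.\<close>

definition dir_poly :: "int \<times> int \<Rightarrow> int poly poly" where
  "dir_poly = (\<lambda>(a, b).
     if a > 0 \<and> b > 0 then xy_monom (nat a) (nat b) - 1
     else if a > 0 \<and> b < 0 then xy_monom (nat a) 0 - xy_monom 0 (nat (- b))
     else if (a, b) = (1, 0) then xy_monom 1 0 - 1
     else xy_monom 0 1 - 1)"

definition F_poly :: "(int \<times> int) set \<Rightarrow> int poly poly" where
  "F_poly S = (\<Prod>d\<in>S. dir_poly d)"

definition R_sum :: "(int \<times> int) set \<Rightarrow> int" where
  "R_sum S = (\<Sum>j\<le>degree (F_poly S). \<Sum>i\<le>degree (coeff (F_poly S) j).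
                (coeff (coeff (F_poly S) j) i)\<^sup>2)"

end

theory Submission
  imports Defs "HOL-Library.Product_Plus"
begin

text \<open>Everything is done modulo \<open>\<int>\<close>: a function on the grid whose line sums in the directions of
  \<open>S\<close> are integers is congruent to a real combination of the translates of \<open>F_S\<close> that fit into the
  grid. This is shown one direction at a time: dividing by \<open>f_d\<close> means taking partial sums along the
  lines with direction \<open>d\<close>, and the line sums of the quotient in another direction are periodic
  modulo \<open>\<int>\<close> and vanish far away, hence are integers. Now round the coefficients of the combination
  to integers one after the other. Rounding up with probability equal to the fractional part would
  add in the mean at most \<open>R(S)/4\<close> to the squared norm of the error, so one of the two choices does
  so as well; there are \<open>(m - M)(n - N)\<close> translates, and subtracting the total error from \<open>h\<close> gives
  an integer function with unchanged line sums.\<close>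

section \<open>Line sums\<close>

text \<open>The determinant of \<open>d\<close> and \<open>p\<close>. The lines with direction
  \<open>d\<close> are its level sets, and translating by \<open>v\<close> shifts the line parameter
  by \<open>offset d v\<close>.\<close>

definition offset :: "int \<times> int \<Rightarrow> int \<times> int \<Rightarrow> int" where
  "offset d p = fst d * snd p - snd d * fst p"

lemma offset_add: "offset d (p + q) = offset d p + offset d q"
  and offset_diff: "offset d (p - q) = offset d p - offset d q"
  by (simp_all add: offset_def algebra_simps)

lemma line_sum_eq_sum_offset: "line_sum A g d t = sum g {p \<in> A. offset d p = t}"
proof -
  have "{(i, j). (i, j) \<in> A \<and> fst d * j = snd d * i + t} = {p \<in> A. offset d p = t}"
    by (auto simp: offset_def)
  then show ?thesis
    by (simp add: line_sum_def case_prod_unfold split_beta)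
qed

lemma finite_grid [simp]: "finite (grid m n)"
proof -
  have "grid m n = {0..<int m} \<times> {0..<int n}"
    by (auto simp: grid_def)
  then show ?thesis by simp
qed

lemma card_grid: "card (grid m n) = m * n"
proof -
  have "grid m n = {0..<int m} \<times> {0..<int n}"
    by (auto simp: grid_def)
  then show ?thesis by simp
qed

lemma mem_grid: "p \<in> grid m n \<longleftrightarrow> 0 \<le> fst p \<and> fst p < int m \<and> 0 \<le> snd p \<and> snd p < int n"
  by (cases p) (simp add: grid_def)

lemma line_sum_diff: "line_sum A (\<lambda>p. f p - g p) d t = line_sum A f d t - line_sum A g d t"
  by (simp add: line_sum_eq_sum_offset sum_subtractf)

text \<open>\<open>B\<close> contains the support of \<open>g\<close> and fits into \<open>A\<close>
  after the shift; points of \<open>A\<close> outside the shifted \<open>B\<close> contribute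
  0.\<close>

lemma line_sum_translate:
  assumes "finite A" and "\<And>p. p \<in> B \<Longrightarrow> p + v \<in> A" and "\<And>p. p \<notin> B \<Longrightarrow> g p = 0"
  shows "line_sum A (\<lambda>p. g (p - v)) d t = line_sum B g d (t - offset d v)"
proof -
  have "sum g {p \<in> B. offset d p = t - offset d v}
      = sum (\<lambda>p. g (p - v)) ((\<lambda>p. p + v) ` {p \<in> B. offset d p = t - offset d v})"
    by (subst sum.reindex) (auto simp: inj_on_def)
  also have "\<dots> = sum (\<lambda>p. g (p - v)) {p \<in> A. offset d p = t}"
  proof (rule sum.mono_neutral_left)
    show "\<forall>p\<in>{p \<in> A. offset d p = t} - (\<lambda>p. p + v) ` {p \<in> B. offset d p = t - offset d v}.
        g (p - v) = 0"
    proof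
      fix p assume "p \<in> {p \<in> A. offset d p = t} - (\<lambda>p. p + v) ` {p \<in> B. offset d p = t - offset d v}"
      then have "p - v \<notin> B"
        using image_eqI[of p "\<lambda>p. p + v" "p - v" "{p \<in> B. offset d p = t - offset d v}"]
        by (auto simp: offset_diff)
      then show "g (p - v) = 0" by (rule assms)
    qed
  qed (use assms in \<open>auto simp: offset_add\<close>)
  finally show ?thesis by (simp add: line_sum_eq_sum_offset)
qed

lemma line_sum_eq_0_far:
  assumes "finite A"
  obtains B where "\<And>t. B < \<bar>t\<bar> \<Longrightarrow> line_sum A g d t = 0"
proof -
  have "finite ((\<lambda>p. \<bar>offset d p\<bar>) ` A)" using assms by simp
  then obtain B where B: "\<And>p. p \<in> A \<Longrightarrow> \<bar>offset d p\<bar> \<le> B"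
    by (meson Max_ge imageI)
  have "line_sum A g d t = 0" if "B < \<bar>t\<bar>" for t
  proof -
    have "{p \<in> A. offset d p = t} = {}" using B that by fastforce
    then show ?thesis by (simp only: line_sum_eq_sum_offset sum.empty)
  qed
  then show ?thesis using that by blast
qed

text \<open>Each step by \<open>\<delta>\<close> changes \<open>L\<close> by an integer, and enough
  steps lead to a point where \<open>L\<close> vanishes.\<close>

lemma Ints_if_periodic_mod_Ints:
  fixes L :: "int \<Rightarrow> real"
  assumes "\<delta> \<noteq> 0" and per: "\<And>t. L (t + \<delta>) - L t \<in> \<int>" and far: "\<And>t. B < \<bar>t\<bar> \<Longrightarrow> L t = 0"
  shows "L t \<in> \<int>"
proof -
  have *: "L (t + int k * \<delta>) - L t \<in> \<int>" for k
  proof (induction k)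
    case (Suc k)
    have "L (t + int (Suc k) * \<delta>) - L t
        = (L (t + int k * \<delta> + \<delta>) - L (t + int k * \<delta>)) + (L (t + int k * \<delta>) - L t)"
      by (simp add: algebra_simps)
    then show ?case by (simp only: Ints_add[OF per Suc])
  qed simp
  \<comment> \<open>As \<open>\<bar>\<delta>\<bar> \<ge> 1\<close>, this many steps from
    \<open>t\<close> end at distance more than \<open>B\<close> from 0.\<close>
  define k where "k = nat (\<bar>B\<bar> + \<bar>t\<bar> + 1)"
  have "int k * 1 \<le> int k * \<bar>\<delta>\<bar>"
    using assms(1) by (intro mult_left_mono) auto
  then have "\<bar>B\<bar> + \<bar>t\<bar> + 1 \<le> \<bar>int k * \<delta>\<bar>" by (simp add: k_def abs_mult)
  then have "L (t + int k * \<delta>) = 0" by (intro far) linarith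
  with *[of k] have "- L t \<in> \<int>" by simp
  then show ?thesis by (simp only: minus_in_Ints_iff)
qed

section \<open>Directions\<close>

text \<open>The exponents of the two monomials of \<open>f_d\<close>, the first one carrying the sign \<open>+\<close>.\<close>

definition pos_exp :: "int \<times> int \<Rightarrow> int \<times> int" where
  "pos_exp d = (fst d, max (snd d) 0)"

definition neg_exp :: "int \<times> int \<Rightarrow> int \<times> int" where
  "neg_exp d = (0, max (- snd d) 0)"

text \<open>The two monomials of \<open>dir_poly d\<close> thus lie on a common line with direction
  \<open>d\<close>, so \<open>dir_poly d\<close> acts as a difference operator along such
  lines.\<close>

lemma pos_exp_eq: "pos_exp d = neg_exp d + d"
  by (cases d) (auto simp: pos_exp_def neg_exp_def)

lemma is_direction_iff:
  "is_direction d \<longleftrightarrow> coprime (fst d) (snd d) \<and> fst d \<ge> 0 \<and> (fst d = 0 \<longrightarrow> snd d = 1)"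
  by (cases d) (auto simp: is_direction_def coprime_iff_gcd_eq_1)

lemma direction_imp_coprime: "is_direction d \<Longrightarrow> coprime (fst d) (snd d)"
  by (simp add: is_direction_iff)

lemma offset_eq_0_imp_multiple:
  assumes "coprime (fst d) (snd d)" and "offset d p = 0"
  shows "\<exists>k. p = (k * fst d, k * snd d)"
proof -
  obtain a b i j where [simp]: "d = (a, b)" "p = (i, j)" by (cases d, cases p)
  have eq: "a * j = b * i" and cop: "coprime a b" using assms by (auto simp: offset_def)
  then have "a dvd i" "b dvd j"
    by (metis coprime_dvd_mult_right_iff dvd_triv_left)
       (metis cop eq coprime_commute coprime_dvd_mult_right_iff dvd_triv_left)
  then obtain k l where kl: "i = a * k" "j = b * l" by (auto elim!: dvdE)
  show ?thesis
  \<comment> \<open>Cancelling \<open>a * b\<close> in \<open>eq\<close> yields \<open>k = l\<close>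
    if both factors are nonzero. Otherwise the cofactor of the nonzero coordinate is the multiple
    sought.\<close>
  proof (cases "a = 0 \<or> b = 0")
    case True
    then show ?thesis using kl cop
      by (auto intro: exI[of _ l] exI[of _ k])
  next
    case False
    then have "k = l" using eq kl by simp
    then show ?thesis using kl by (auto intro: exI[of _ k])
  qed
qed

text \<open>Parallel primitive vectors agree up to sign, and the normalization of directions
  excludes the sign -1.\<close>

lemma distinct_directions_offset:
  assumes "is_direction d" "is_direction e" "offset d e = 0"
  shows "d = e"
proof -
  obtain k where k: "e = (k * fst d, k * snd d)"
    using offset_eq_0_imp_multiple[OF direction_imp_coprime[OF assms(1)] assms(3)] by auto
  have "is_unit k"
    using direction_imp_coprime[OF assms(2)] unfolding k coprime_def by auto
  then have "k = 1 \<or> k = -1" by auto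
  then show ?thesis
    using assms(1,2) k by (cases d) (auto simp: is_direction_iff)
qed

section \<open>Coefficients of the polynomial of a set of directions\<close>

text \<open>Extending the coefficients by 0 to the whole plane turns multiplication by a monomial
  into a plain shift. The sign test is essential because \<open>nat\<close> maps negative integers
  to 0.\<close>

definition plane_coeff :: "int poly poly \<Rightarrow> int \<times> int \<Rightarrow> real" where
  "plane_coeff G p = (if fst p < 0 \<or> snd p < 0 then 0
     else real_of_int (coeff (coeff G (nat (snd p))) (nat (fst p))))"

lemma plane_coeff_1: "plane_coeff 1 p = (if p = 0 then 1 else 0)"
  by (cases p) (auto simp: plane_coeff_def coeff_1 zero_prod_def nat_eq_iff split: if_splits)

lemma plane_coeff_diff: "plane_coeff (G - H) p = plane_coeff G p - plane_coeff H p"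
  by (simp add: plane_coeff_def)

lemma plane_coeff_xy_monom_mult:
  "plane_coeff (xy_monom i j * G) p = plane_coeff G (p - (int i, int j))"
proof -
  have "nat (x - int i) = nat x - i" "\<not> i \<le> nat x \<longleftrightarrow> x - int i < 0" if "0 \<le> x" for x i
    using that by auto
  then show ?thesis
    by (cases p) (auto simp: plane_coeff_def xy_monom_def coeff_monom_mult)
qed

lemma dir_poly_eq:
  assumes "is_direction d"
  shows "dir_poly d = xy_monom (nat (fst (pos_exp d))) (nat (snd (pos_exp d)))
    - xy_monom (nat (fst (neg_exp d))) (nat (snd (neg_exp d)))"
proof -
  have "xy_monom 0 0 = 1" by (simp add: xy_monom_def)
  then show ?thesis using assms
    by (cases d) (auto simp: dir_poly_def is_direction_def pos_exp_def neg_exp_def)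
qed

lemma plane_coeff_dir_poly_mult:
  assumes "is_direction d"
  shows "plane_coeff (dir_poly d * G) p
    = plane_coeff G (p - pos_exp d) - plane_coeff G (p - neg_exp d)"
proof -
  have "0 \<le> fst d" using assms by (simp add: is_direction_iff)
  then show ?thesis
    unfolding dir_poly_eq[OF assms] left_diff_distrib plane_coeff_diff plane_coeff_xy_monom_mult
    by (simp add: pos_exp_def neg_exp_def)
qed

lemma width_insert: "finite S \<Longrightarrow> d \<notin> S \<Longrightarrow> width (insert d S) = fst d + width S"
  and height_insert: "finite S \<Longrightarrow> d \<notin> S \<Longrightarrow> height (insert d S) = \<bar>snd d\<bar> + height S"
  and F_poly_insert: "finite S \<Longrightarrow> d \<notin> S \<Longrightarrow> F_poly (insert d S) = dir_poly d * F_poly S"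
  by (simp_all add: width_def height_def F_poly_def case_prod_unfold)

lemma width_nonneg: "\<forall>d\<in>S. is_direction d \<Longrightarrow> 0 \<le> width S"
  and height_nonneg: "0 \<le> height S"
  by (auto simp: width_def height_def is_direction_iff intro!: sum_nonneg)

text \<open>Each factor \<open>dir_poly d\<close> combines two shifts of the previous coefficients,
  which enlarges the bounding box by \<open>fst d\<close> and
  \<open>\<bar>snd d\<bar>\<close>.\<close>

lemma F_poly_support:
  assumes "finite S" "\<forall>d\<in>S. is_direction d" "plane_coeff (F_poly S) p \<noteq> 0"
  shows "0 \<le> fst p \<and> fst p \<le> width S \<and> 0 \<le> snd p \<and> snd p \<le> height S"
  using assms
proof (induction S arbitrary: p)
  case empty
  then show ?case
    by (auto simp: F_poly_def plane_coeff_1 width_def height_def split: if_splits)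
next
  case (insert d S)
  have dir: "is_direction d" using insert by simp
  then have a: "0 \<le> fst d" by (simp add: is_direction_iff)
  from insert have "plane_coeff (F_poly S) (p - pos_exp d) \<noteq> 0
      \<or> plane_coeff (F_poly S) (p - neg_exp d) \<noteq> 0"
    by (auto simp: F_poly_insert plane_coeff_dir_poly_mult[OF dir])
  then obtain v where v: "v = pos_exp d \<or> v = neg_exp d" "plane_coeff (F_poly S) (p - v) \<noteq> 0"
    by metis
  from insert.IH[OF _ v(2)] insert.prems v(1) a show ?case
    by (auto simp: width_insert[OF insert.hyps] height_insert[OF insert.hyps]
        pos_exp_def neg_exp_def)
qed

text \<open>Only an inequality, since \<open>A\<close> may cut off part of the translate.\<close>

lemma sum_plane_coeff_squares_le:
  assumes "finite A"
  shows "(\<Sum>p\<in>A. (plane_coeff (F_poly S) (p - z))\<^sup>2) \<le> real_of_int (R_sum S)"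
proof -
  define G where "G = F_poly S"
  define I where "I = (SIGMA j:{..degree G}. {..degree (coeff G j)})"
  \<comment> \<open>\<open>I\<close> lists exponents as \<open>R_sum\<close> does, that of
    \<open>y\<close> first, so \<open>e\<close> swaps the coordinates.\<close>
  define e :: "nat \<times> nat \<Rightarrow> int \<times> int" where "e = (\<lambda>(j, i). (int i, int j))"
  have outside: "plane_coeff G p = 0" if "p \<notin> e ` I" for p
  proof (rule ccontr)
    assume ne: "plane_coeff G p \<noteq> 0"
    then have c: "0 \<le> fst p" "0 \<le> snd p" "coeff (coeff G (nat (snd p))) (nat (fst p)) \<noteq> 0"
      by (auto simp: plane_coeff_def split: if_splits)
    then have "coeff G (nat (snd p)) \<noteq> 0" by auto
    with c have "(nat (snd p), nat (fst p)) \<in> I"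
      by (auto simp: I_def intro!: le_degree)
    moreover have "e (nat (snd p), nat (fst p)) = p" using c by (simp add: e_def)
    ultimately show False using that by (metis imageI)
  qed
  have fin: "finite (e ` I)" by (auto simp: I_def)
  have "(\<Sum>p\<in>A. (plane_coeff G (p - z))\<^sup>2) = (\<Sum>p\<in>(\<lambda>p. p - z) ` A. (plane_coeff G p)\<^sup>2)"
    by (subst sum.reindex) (auto simp: inj_on_def)
  also have "\<dots> = (\<Sum>p\<in>(\<lambda>p. p - z) ` A \<inter> e ` I. (plane_coeff G p)\<^sup>2)"
    using assms outside by (intro sum.mono_neutral_right) auto
  also have "\<dots> \<le> (\<Sum>p\<in>e ` I. (plane_coeff G p)\<^sup>2)"
    using fin by (intro sum_mono2) auto
  also have "\<dots> = (\<Sum>(j, i)\<in>I. (real_of_int (coeff (coeff G j) i))\<^sup>2)"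
    by (subst sum.reindex)
       (auto simp: inj_on_def e_def plane_coeff_def case_prod_unfold prod_eq_iff intro!: sum.cong)
  also have "\<dots> = real_of_int (R_sum S)"
    by (simp add: R_sum_def I_def G_def sum.Sigma case_prod_unfold)
  finally show ?thesis by (simp add: G_def)
qed

text \<open>Split off the factor of \<open>d\<close>: what remains is a difference of two copies of
  \<open>F_poly T\<close> shifted against each other by \<open>d\<close>, and these have equal sums
  on every line with direction \<open>d\<close>.\<close>

lemma line_sum_F_poly_translate:
  assumes "finite S" "\<forall>d\<in>S. is_direction d" "d \<in> S"
    and z: "z \<in> grid (nat (int m - width S)) (nat (int n - height S))"
  shows "line_sum (grid m n) (\<lambda>p. plane_coeff (F_poly S) (p - z)) d t = 0"
proof -
  define T where "T = S - {d}"
  have T: "finite T" "d \<notin> T" "S = insert d T" "\<forall>d\<in>T. is_direction d"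
    using assms by (auto simp: T_def)
  have dir: "is_direction d" using assms by auto
  then have a: "0 \<le> fst d" by (simp add: is_direction_iff)
  define B where "B = {p. 0 \<le> fst p \<and> fst p \<le> width T \<and> 0 \<le> snd p \<and> snd p \<le> height T}"
  define g where "g = plane_coeff (F_poly T)"
  have g0: "g p = 0" if "p \<notin> B" for p
    using F_poly_support[OF T(1,4), of p] that unfolding B_def g_def by blast
  \<comment> \<open>The range of \<open>z\<close> is exactly what keeps both shifted boxes inside
    the grid.\<close>
  have sub: "p + (z + v) \<in> grid m n" if "p \<in> B" "v = pos_exp d \<or> v = neg_exp d" for p v
    using that z a
    by (auto simp: B_def mem_grid T(3) width_insert[OF T(1,2)] height_insert[OF T(1,2)]
        pos_exp_def neg_exp_def split: if_splits)
  have "plane_coeff (F_poly S) (p - z) = g (p - (z + pos_exp d)) - g (p - (z + neg_exp d))" for p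
    by (simp add: T(3) F_poly_insert[OF T(1,2)] plane_coeff_dir_poly_mult[OF dir] g_def diff_diff_eq)
  then have "line_sum (grid m n) (\<lambda>p. plane_coeff (F_poly S) (p - z)) d t
      = line_sum B g d (t - offset d (z + pos_exp d)) - line_sum B g d (t - offset d (z + neg_exp d))"
    using g0 sub by (simp add: line_sum_diff line_sum_translate[where B = B])
  also have "offset d (z + pos_exp d) = offset d (z + neg_exp d)"
    by (simp add: pos_exp_eq offset_add) (simp add: offset_def)
  finally show ?thesis by simp
qed

section \<open>Division modulo the integers\<close>

text \<open>Partial sums along the lines with direction \<open>d\<close> solve the difference
  equation exactly. Outside the region where the quotient may live, such a sum is empty or a full
  line sum, hence an integer, and can be replaced by 0.\<close>

lemma divide_by_direction:
  fixes h :: "int \<times> int \<Rightarrow> real"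
  assumes dir: "is_direction d"
    and supp: "\<And>p. p \<notin> grid m n \<Longrightarrow> h p = 0"
    and int_sums: "\<And>t. line_sum (grid m n) h d t \<in> \<int>"
  obtains q where
    "\<And>p. p \<notin> grid (nat (int m - fst d)) (nat (int n - \<bar>snd d\<bar>)) \<Longrightarrow> q p = 0"
    "\<And>p. h p - (q (p - pos_exp d) - q (p - neg_exp d)) \<in> \<int>"
proof -
  obtain a b where d [simp]: "d = (a, b)" by (cases d)
  have a: "0 \<le> a" "a = 0 \<Longrightarrow> b = 1" using dir by (auto simp: is_direction_iff)
  define G' where "G' = grid (nat (int m - a)) (nat (int n - \<bar>b\<bar>))"
  define behind where "behind p = {z \<in> grid m n. \<exists>k\<ge>0. z = p - (k * a, k * b)}" for p
  \<comment> \<open>The minus sign matches the \<open>+\<close> of \<open>pos_exp\<close>: since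
    \<open>behind p\<close> contains \<open>p\<close> itself, \<open>u (p - d) - u p\<close> is
    \<open>h p\<close>.\<close>
  define u where "u p = - sum h (behind p)" for p
  \<comment> \<open>The shift makes \<open>q (p - neg_exp d)\<close> stand for \<open>u p\<close>
    and \<open>q (p - pos_exp d)\<close> for \<open>u (p - d)\<close>.\<close>
  define q where "q p = (if p \<in> G' then u (p + neg_exp d) else 0)" for p
  have step: "h p = u (p - d) - u p" for p
  proof -
    have 1: "behind p = (if p \<in> grid m n then insert p (behind (p - d)) else behind (p - d))"
    proof -
      have "(\<exists>k\<ge>0. z = p - (k * a, k * b)) \<longleftrightarrow> z = p \<or> (\<exists>k\<ge>0. z = p - d - (k * a, k * b))" for z
      proof safe
        fix k :: int assume k: "0 \<le> k" "\<nexists>l. 0 \<le> l \<and> p - (k * a, k * b) = p - d - (l * a, l * b)"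
        have "k = 0"
        proof (rule ccontr)
          assume "k \<noteq> 0"
          then have "0 \<le> k - 1" "p - (k * a, k * b) = p - d - ((k - 1) * a, (k - 1) * b)"
            using k by (auto simp: prod_eq_iff algebra_simps)
          with k show False by blast
        qed
        then show "p - (k * a, k * b) = p" by (simp add: prod_eq_iff)
      next
        show "\<exists>k\<ge>0. p = p - (k * a, k * b)" by (intro exI[of _ 0]) (simp add: prod_eq_iff)
      next
        fix k :: int assume "0 \<le> k"
        then show "\<exists>l\<ge>0. p - d - (k * a, k * b) = p - (l * a, l * b)"
          by (intro exI[of _ "k + 1"]) (auto simp: prod_eq_iff algebra_simps)
      qed
      then show ?thesis by (auto simp: behind_def)
    qed
    have "p \<notin> behind (p - d)"
    proof
      assume "p \<in> behind (p - d)"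
      then obtain k where "0 \<le> k" "(k + 1) * a = 0" "(k + 1) * b = 0"
        by (cases p) (auto simp: behind_def algebra_simps)
      then show False using a by auto
    qed
    moreover have "finite (behind p)" for p by (simp add: behind_def)
    ultimately show ?thesis using supp[of p] by (simp add: u_def 1)
  qed
  have cong: "u p - q (p - neg_exp d) \<in> \<int>" for p
  proof (cases "p - neg_exp d \<in> G'")
    case False
    \<comment> \<open>Either the ray backwards from \<open>p\<close>, including \<open>p\<close>,
      misses the grid, or the ray strictly ahead of \<open>p\<close> does. The sign of
      \<open>b\<close> decides which sides of the grid bound which ray.\<close>
    consider "\<And>k. 0 \<le> k \<Longrightarrow> p - (k * a, k * b) \<notin> grid m n"
      | "\<And>k. k < 0 \<Longrightarrow> p - (k * a, k * b) \<notin> grid m n"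
    proof -
      have ka: "k \<ge> 0 \<Longrightarrow> k * a \<ge> 0" "k < 0 \<Longrightarrow> k * a \<le> - a" for k
        using a mult_right_mono[of k "-1" a] by auto
      have kb: "b \<ge> 0 \<Longrightarrow> k \<ge> 0 \<Longrightarrow> k * b \<ge> 0" "b \<ge> 0 \<Longrightarrow> k < 0 \<Longrightarrow> k * b \<le> - b"
        "b < 0 \<Longrightarrow> k \<ge> 0 \<Longrightarrow> k * b \<le> 0" "b < 0 \<Longrightarrow> k < 0 \<Longrightarrow> k * b \<ge> - b" for k
        using mult_right_mono[of k "-1" b] mult_right_mono_neg[of k "-1" b]
        by (auto simp: mult_nonneg_nonpos)
      show thesis
      proof (cases "b \<ge> 0")
        case True
        from False True
        have "fst p < 0 \<or> snd p < 0 \<or> fst p \<ge> int m - a \<or> snd p \<ge> int n - b"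
          by (auto simp: G'_def mem_grid neg_exp_def split: if_splits)
        then consider "fst p < 0 \<or> snd p < 0" | "fst p \<ge> int m - a \<or> snd p \<ge> int n - b"
          by blast
        then show thesis
        proof cases
          case 1
          then have "p - (k * a, k * b) \<notin> grid m n" if "0 \<le> k" for k
            using ka(1)[OF that] kb(1)[OF True that] by (auto simp: mem_grid)
          then show thesis by (rule that(1))
        next
          case 2
          then have "p - (k * a, k * b) \<notin> grid m n" if "k < 0" for k
            using ka(2)[OF that] kb(2)[OF True that] by (auto simp: mem_grid)
          then show thesis by (rule that(2))
        qed
      next
        case neg: False
        then have b: "b < 0" by simp
        from False neg
        have "fst p < 0 \<or> snd p \<ge> int n \<or> fst p \<ge> int m - a \<or> snd p < - b"
          by (auto simp: G'_def mem_grid neg_exp_def split: if_splits)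
        then consider "fst p < 0 \<or> snd p \<ge> int n" | "fst p \<ge> int m - a \<or> snd p < - b"
          by blast
        then show thesis
        proof cases
          case 1
          then have "p - (k * a, k * b) \<notin> grid m n" if "0 \<le> k" for k
            using ka(1)[OF that] kb(3)[OF b that] by (auto simp: mem_grid)
          then show thesis by (rule that(1))
        next
          case 2
          then have "p - (k * a, k * b) \<notin> grid m n" if "k < 0" for k
            using ka(2)[OF that] kb(4)[OF b that] by (auto simp: mem_grid)
          then show thesis by (rule that(2))
        qed
      qed
    qed
    then have "u p \<in> \<int>"
    proof cases
      case 1
      then have "behind p = {}" by (auto simp: behind_def)
      then show ?thesis by (simp add: u_def)
    next
      case 2
      \<comment> \<open>Nothing of the grid lies ahead of \<open>p\<close>, so the backward ray
        meets all grid points of the line through \<open>p\<close>; coprimality makes each of them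
        an integer multiple of \<open>d\<close> away.\<close>
      have "behind p = {z \<in> grid m n. offset d z = offset d p}"
      proof safe
        fix x y assume z: "(x, y) \<in> grid m n" "offset d (x, y) = offset d p"
        then have "offset d (p - (x, y)) = 0" by (simp add: offset_diff)
        then obtain k where k: "p - (x, y) = (k * a, k * b)"
          using offset_eq_0_imp_multiple[OF direction_imp_coprime[OF dir], of "p - (x, y)"] by auto
        then have eq: "(x, y) = p - (k * a, k * b)" by (cases p) auto
        with 2[of k] z have "0 \<le> k" by fastforce
        with eq z(1) show "(x, y) \<in> behind p" unfolding behind_def by blast
      qed (auto simp: behind_def offset_diff, auto simp: offset_def)
      then have "u p = - line_sum (grid m n) h d (offset d p)"
        by (simp add: u_def line_sum_eq_sum_offset)
      then show ?thesis using int_sums by simp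
    qed
    then show ?thesis using False by (simp add: q_def)
  qed (simp add: q_def)
  show ?thesis
  proof
    show "q p = 0" if "p \<notin> grid (nat (int m - fst d)) (nat (int n - \<bar>snd d\<bar>))" for p
      using that by (simp add: q_def G'_def)
  next
    fix p
    have "p - pos_exp d = p - d - neg_exp d" by (simp add: pos_exp_eq algebra_simps)
    with step[of p] have "h p - (q (p - pos_exp d) - q (p - neg_exp d))
        = (u (p - d) - q (p - d - neg_exp d)) - (u p - q (p - neg_exp d))"
      by (simp only:)
    then show "h p - (q (p - pos_exp d) - q (p - neg_exp d)) \<in> \<int>"
      by (simp only: Ints_diff[OF cong cong])
  qed
qed

text \<open>Summing the congruence along \<open>e\<close> shows that the line sums of
  \<open>q\<close> are periodic modulo \<open>\<int>\<close>. The period \<open>offset e d\<close>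
  is nonzero as distinct directions are not parallel, and the sums vanish far away.\<close>

lemma quotient_line_sums:
  fixes h q :: "int \<times> int \<Rightarrow> real"
  assumes dir: "is_direction d" "is_direction e" "d \<noteq> e"
    and supp: "\<And>p. p \<notin> grid (nat (int m - fst d)) (nat (int n - \<bar>snd d\<bar>)) \<Longrightarrow> q p = 0"
    and cong: "\<And>p. h p - (q (p - pos_exp d) - q (p - neg_exp d)) \<in> \<int>"
    and int_sums: "\<And>t. line_sum (grid m n) h e t \<in> \<int>"
  shows "line_sum (grid (nat (int m - fst d)) (nat (int n - \<bar>snd d\<bar>))) q e t \<in> \<int>"
proof -
  define G' where "G' = grid (nat (int m - fst d)) (nat (int n - \<bar>snd d\<bar>))"
  define L where "L = line_sum G' q e"
  have "0 \<le> fst d" using dir by (simp add: is_direction_iff)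
  then have sub: "p + v \<in> grid m n" if "p \<in> G'" "v = pos_exp d \<or> v = neg_exp d" for p v
    using that by (auto simp: G'_def mem_grid pos_exp_def neg_exp_def split: if_splits)
  have tr: "line_sum (grid m n) (\<lambda>p. q (p - v)) e t = L (t - offset e v)"
    if "v = pos_exp d \<or> v = neg_exp d" for v t
    unfolding L_def using sub that supp by (intro line_sum_translate) (auto simp: G'_def)
  have mod: "L (t - offset e (pos_exp d)) - L (t - offset e (neg_exp d)) \<in> \<int>" for t
  proof -
    have "line_sum (grid m n) (\<lambda>p. h p - (q (p - pos_exp d) - q (p - neg_exp d))) e t \<in> \<int>"
      unfolding line_sum_eq_sum_offset by (intro Ints_sum cong)
    then have "line_sum (grid m n) h e t
        - (L (t - offset e (pos_exp d)) - L (t - offset e (neg_exp d))) \<in> \<int>"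
      by (simp add: line_sum_diff tr)
    from Ints_diff[OF int_sums[of t] this] show ?thesis by simp
  qed
  define \<delta> where "\<delta> = - offset e d"
  have "\<delta> \<noteq> 0" using distinct_directions_offset[OF dir(2,1)] dir(3) by (auto simp: \<delta>_def)
  moreover have "L (t + \<delta>) - L t \<in> \<int>" for t
    using mod[of "t + offset e (neg_exp d)"]
    by (simp add: \<delta>_def pos_exp_eq offset_add algebra_simps)
  moreover obtain B where "\<And>t. B < \<bar>t\<bar> \<Longrightarrow> L t = 0"
    unfolding L_def G'_def using line_sum_eq_0_far[OF finite_grid] by blast
  ultimately show ?thesis
    using Ints_if_periodic_mod_Ints unfolding L_def G'_def by blast
qed

text \<open>Induction over the directions with grid and function varying: the quotient by
  \<open>dir_poly d\<close> lives on a smaller grid and keeps integer line sums in the remaining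
  directions.\<close>

lemma F_poly_combination_mod_Ints:
  fixes h :: "int \<times> int \<Rightarrow> real"
  assumes "finite S" "\<forall>d\<in>S. is_direction d" "width S \<le> int m" "height S \<le> int n"
    and "\<And>p. p \<notin> grid m n \<Longrightarrow> h p = 0"
    and "\<And>d t. d \<in> S \<Longrightarrow> line_sum (grid m n) h d t \<in> \<int>"
  shows "\<exists>c. \<forall>p. h p - (\<Sum>z\<in>grid (nat (int m - width S)) (nat (int n - height S)).
    c z * plane_coeff (F_poly S) (p - z)) \<in> \<int>"
  using assms
proof (induction S arbitrary: m n h)
  case empty
  \<comment> \<open>The empty product is 1, so \<open>h\<close> is its own family of
    coefficients.\<close>
  have "(\<Sum>z\<in>grid m n. h z * plane_coeff 1 (p - z)) = h p" for p
  proof -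
    have "h z * plane_coeff 1 (p - z) = (if z = p then h z else 0)" for z
      by (auto simp: plane_coeff_1)
    then show ?thesis using empty.prems(4) by simp
  qed
  then show ?case
    by (intro exI[of _ h]) (simp add: F_poly_def width_def height_def)
next
  case (insert d S)
  have dir: "is_direction d" "\<forall>e\<in>S. is_direction e" using insert.prems by auto
  define m' n' where "m' = nat (int m - fst d)" and "n' = nat (int n - \<bar>snd d\<bar>)"
  obtain q where q: "\<And>p. p \<notin> grid m' n' \<Longrightarrow> q p = 0"
      "\<And>p. h p - (q (p - pos_exp d) - q (p - neg_exp d)) \<in> \<int>"
    unfolding m'_def n'_def
    using divide_by_direction[OF dir(1) insert.prems(4) insert.prems(5)[OF insertI1]] by blast
  have wh: "width (insert d S) = fst d + width S" "height (insert d S) = \<bar>snd d\<bar> + height S"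
    using insert.hyps by (simp_all add: width_insert height_insert)
  have nonneg: "0 \<le> width S" "0 \<le> height S"
    using dir by (simp_all add: width_nonneg height_nonneg)
  have m': "int m' = int m - fst d" "int n' = int n - \<bar>snd d\<bar>"
    using insert.prems(2,3) wh nonneg by (simp_all add: m'_def n'_def)
  have q_sums: "line_sum (grid m' n') q e t \<in> \<int>" if "e \<in> S" for e t
    unfolding m'_def n'_def
  proof (rule quotient_line_sums)
    show "d \<noteq> e" using insert.hyps that by auto
    show "line_sum (grid m n) h e t \<in> \<int>" for t
      using that by (intro insert.prems(5)) simp
  qed (use dir that q m'_def n'_def in auto)
  define Z where "Z = grid (nat (int m' - width S)) (nat (int n' - height S))"
  obtain c where c: "\<And>p. q p - (\<Sum>z\<in>Z. c z * plane_coeff (F_poly S) (p - z)) \<in> \<int>"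
    unfolding Z_def
    using insert.IH[OF dir(2) _ _ q(1) q_sums] insert.prems(2,3) wh m' by force
  have Z: "grid (nat (int m - width (insert d S))) (nat (int n - height (insert d S))) = Z"
    by (simp add: Z_def wh m' algebra_simps)
  define C where "C p = (\<Sum>z\<in>Z. c z * plane_coeff (F_poly S) (p - z))" for p
  have C: "(\<Sum>z\<in>Z. c z * plane_coeff (F_poly (insert d S)) (p - z))
      = C (p - pos_exp d) - C (p - neg_exp d)" for p
    unfolding F_poly_insert[OF insert.hyps] plane_coeff_dir_poly_mult[OF dir(1)] C_def
    by (simp add: right_diff_distrib sum_subtractf diff_diff_eq add.commute)
  have "h p - (C (p - pos_exp d) - C (p - neg_exp d)) \<in> \<int>" for p
  proof -
    \<comment> \<open>Pass from \<open>h\<close> to \<open>q\<close> and from \<open>q\<close> to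
      \<open>C\<close>; both errors are integers.\<close>
    have "h p - (C (p - pos_exp d) - C (p - neg_exp d))
        = h p - (q (p - pos_exp d) - q (p - neg_exp d))
          + ((q (p - pos_exp d) - C (p - pos_exp d)) - (q (p - neg_exp d) - C (p - neg_exp d)))"
      by simp
    also have "\<dots> \<in> \<int>"
      unfolding C_def by (rule Ints_add[OF q(2) Ints_diff[OF c c]])
    finally show ?thesis .
  qed
  then have "\<forall>p. h p - (\<Sum>z\<in>Z. c z * plane_coeff (F_poly (insert d S)) (p - z)) \<in> \<int>"
    unfolding C by blast
  then show ?case unfolding Z by (rule exI[of _ c])
qed

section \<open>Rounding\<close>

text \<open>Averaging the errors of rounding down and up with weights \<open>1 - \<epsilon>\<close>
  and \<open>\<epsilon>\<close> cancels the term linear in \<open>D\<close> and leaves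
  \<open>\<epsilon> * (1 - \<epsilon>) * B\<close>.\<close>

lemma rounding_error_step:
  fixes w b :: "'a \<Rightarrow> real" and c :: real
  shows "\<exists>k::int. (\<Sum>p\<in>A. (w p + (c - k) * b p)\<^sup>2)
    \<le> (\<Sum>p\<in>A. (w p)\<^sup>2) + 1/4 * (\<Sum>p\<in>A. (b p)\<^sup>2)"
proof -
  define \<epsilon> where "\<epsilon> = frac c"
  have \<epsilon>: "0 \<le> \<epsilon>" "\<epsilon> < 1" by (simp_all add: \<epsilon>_def frac_ge_0 frac_lt_1)
  define W where "W x = (\<Sum>p\<in>A. (w p + x * b p)\<^sup>2)" for x
  define V D B where "V = (\<Sum>p\<in>A. (w p)\<^sup>2)" and "D = (\<Sum>p\<in>A. w p * b p)"
    and "B = (\<Sum>p\<in>A. (b p)\<^sup>2)"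
  have W: "W x = V + 2 * x * D + x\<^sup>2 * B" for x
    unfolding W_def V_def D_def B_def
    by (simp add: power2_sum power_mult_distrib sum.distrib sum_distrib_left algebra_simps)
  have "(1 - \<epsilon>) * W \<epsilon> + \<epsilon> * W (\<epsilon> - 1) = V + \<epsilon> * (1 - \<epsilon>) * B"
    unfolding W by (simp add: algebra_simps power2_eq_square)
  also have "\<dots> \<le> V + 1/4 * B"
  proof -
    have "\<epsilon> * (1 - \<epsilon>) \<le> 1/4"
      using zero_le_power2[of "\<epsilon> - 1/2"] by (simp add: power2_eq_square algebra_simps)
    moreover have "0 \<le> B" by (simp add: B_def sum_nonneg)
    ultimately show ?thesis by (intro add_left_mono mult_right_mono)
  qed
  finally have le: "(1 - \<epsilon>) * W \<epsilon> + \<epsilon> * W (\<epsilon> - 1) \<le> V + 1/4 * B" .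
  have "W \<epsilon> \<le> V + 1/4 * B \<or> W (\<epsilon> - 1) \<le> V + 1/4 * B"
  proof (rule ccontr)
    assume "\<not> ?thesis"
    then have "V + 1/4 * B < W \<epsilon>" "V + 1/4 * B \<le> W (\<epsilon> - 1)" by auto
    \<comment> \<open>Strictness comes from the first summand: \<open>1 - \<epsilon>\<close> is
      positive, whereas \<open>\<epsilon>\<close> may be 0.\<close>
    then have "(1 - \<epsilon>) * (V + 1/4 * B) + \<epsilon> * (V + 1/4 * B) < (1 - \<epsilon>) * W \<epsilon> + \<epsilon> * W (\<epsilon> - 1)"
      using \<epsilon> by (intro add_less_le_mono mult_strict_left_mono mult_left_mono) auto
    moreover have "(1 - \<epsilon>) * (V + 1/4 * B) + \<epsilon> * (V + 1/4 * B) = V + 1/4 * B"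
      by algebra
    ultimately show False using le by linarith
  qed
  moreover have "c - real_of_int \<lfloor>c\<rfloor> = \<epsilon>" "c - real_of_int (\<lfloor>c\<rfloor> + 1) = \<epsilon> - 1"
    by (simp_all add: \<epsilon>_def frac_def)
  ultimately have "W (c - real_of_int \<lfloor>c\<rfloor>) \<le> V + 1/4 * B
      \<or> W (c - real_of_int (\<lfloor>c\<rfloor> + 1)) \<le> V + 1/4 * B"
    by (simp only:)
  then show ?thesis unfolding W_def V_def B_def by blast
qed

text \<open>The error accumulated so far enters each step as \<open>w\<close>, so every index adds
  at most a quarter of its own squared norm.\<close>

lemma rounding_error:
  fixes b :: "'i \<Rightarrow> 'a \<Rightarrow> real" and c :: "'i \<Rightarrow> real"
  assumes "finite I"
  shows "\<exists>X :: 'i \<Rightarrow> int. (\<Sum>p\<in>A. (\<Sum>i\<in>I. (c i - X i) * b i p)\<^sup>2)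
    \<le> 1/4 * (\<Sum>i\<in>I. \<Sum>p\<in>A. (b i p)\<^sup>2)"
  using assms
proof (induction I)
  case (insert i I)
  then obtain X :: "'i \<Rightarrow> int" where X: "(\<Sum>p\<in>A. (\<Sum>i\<in>I. (c i - X i) * b i p)\<^sup>2)
      \<le> 1/4 * (\<Sum>i\<in>I. \<Sum>p\<in>A. (b i p)\<^sup>2)"
    by blast
  obtain k :: int where k: "(\<Sum>p\<in>A. ((\<Sum>i\<in>I. (c i - X i) * b i p) + (c i - k) * b i p)\<^sup>2)
      \<le> (\<Sum>p\<in>A. (\<Sum>i\<in>I. (c i - X i) * b i p)\<^sup>2) + 1/4 * (\<Sum>p\<in>A. (b i p)\<^sup>2)"
    using rounding_error_step[where A = A and w = "\<lambda>p. \<Sum>i\<in>I. (c i - X i) * b i p"] by blast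
  have "(\<Sum>l\<in>insert i I. (c l - (X(i := k)) l) * b l p)
      = (\<Sum>i\<in>I. (c i - X i) * b i p) + (c i - k) * b i p" for p
  proof -
    have "(\<Sum>l\<in>I. (c l - (X(i := k)) l) * b l p) = (\<Sum>i\<in>I. (c i - X i) * b i p)"
      using insert.hyps by (intro sum.cong) auto
    then show ?thesis using insert.hyps by simp
  qed
  then have "(\<Sum>p\<in>A. (\<Sum>l\<in>insert i I. (c l - (X(i := k)) l) * b l p)\<^sup>2)
      \<le> 1/4 * (\<Sum>l\<in>I. \<Sum>p\<in>A. (b l p)\<^sup>2) + 1/4 * (\<Sum>p\<in>A. (b i p)\<^sup>2)"
    using X k by simp
  also have "\<dots> = 1/4 * (\<Sum>l\<in>insert i I. \<Sum>p\<in>A. (b l p)\<^sup>2)"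
    using insert.hyps by simp
  finally show ?case by blast
qed simp

section \<open>Assembling the integer function\<close>

theorem theorem5p1:
  fixes m n :: nat and S :: "(int \<times> int) set" and h :: "int \<times> int \<Rightarrow> real"
  assumes "m > 0" and "n > 0"
    and "valid_directions m n S"
    and "\<And>d t. d \<in> S \<Longrightarrow> line_sum (grid m n) h d t \<in> \<int>"
  shows "\<exists>f :: int \<times> int \<Rightarrow> int.
    (\<forall>d\<in>S. \<forall>t. line_sum (grid m n) (\<lambda>p. real_of_int (f p)) d t = line_sum (grid m n) h d t) \<and>
    L2_set (\<lambda>p. real_of_int (f p) - h p) (grid m n)
      \<le> 1 / 2 * sqrt (real_of_int (R_sum S * (int m - width S) * (int n - height S)))"
proof -
  have S: "finite S" "\<forall>d\<in>S. is_direction d" "width S < int m" "height S < int n"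
    using assms(3) by (auto simp: valid_directions_def)
  define A where "A = grid m n"
  define Z where "Z = grid (nat (int m - width S)) (nat (int n - height S))"
  define F where "F z p = plane_coeff (F_poly S) (p - z)" for z p
  \<comment> \<open>\<open>h\<close> is arbitrary off the grid, while the division needs a function
    vanishing there.\<close>
  define h\<^sub>0 where "h\<^sub>0 p = (if p \<in> A then h p else 0)" for p
  have h\<^sub>0: "line_sum A h\<^sub>0 d t = line_sum A h d t" for d t
    unfolding line_sum_eq_sum_offset by (intro sum.cong) (auto simp: h\<^sub>0_def)
  obtain c where c: "\<And>p. h\<^sub>0 p - (\<Sum>z\<in>Z. c z * F z p) \<in> \<int>"
    using F_poly_combination_mod_Ints[of S m n h\<^sub>0] S assms(4) h\<^sub>0
    unfolding Z_def F_def A_def by (auto simp: h\<^sub>0_def A_def)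
  obtain X :: "int \<times> int \<Rightarrow> int" where X: "(\<Sum>p\<in>A. (\<Sum>z\<in>Z. (c z - X z) * F z p)\<^sup>2)
      \<le> 1/4 * (\<Sum>z\<in>Z. \<Sum>p\<in>A. (F z p)\<^sup>2)"
    using rounding_error[of Z c F A] by (auto simp: Z_def)
  define E where "E p = (\<Sum>z\<in>Z. (c z - X z) * F z p)" for p
  \<comment> \<open>The floor only changes the type: \<open>h\<^sub>0 p - E p\<close> is already an
    integer, being a sum of the integer remainder of \<open>h\<^sub>0\<close> and an integer
    combination of integer coefficients.\<close>
  define f where "f p = \<lfloor>h\<^sub>0 p - E p\<rfloor>" for p
  have f: "real_of_int (f p) = h\<^sub>0 p - E p" for p
  proof -
    have "h\<^sub>0 p - E p = (h\<^sub>0 p - (\<Sum>z\<in>Z. c z * F z p)) + (\<Sum>z\<in>Z. X z * F z p)"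
      by (simp add: E_def left_diff_distrib sum_subtractf)
    also have "\<dots> \<in> \<int>"
      by (intro Ints_add[OF c] Ints_sum Ints_mult) (auto simp: F_def plane_coeff_def)
    finally show ?thesis by (simp add: f_def of_int_floor_cancel)
  qed
  have "line_sum A (\<lambda>p. real_of_int (f p)) d t = line_sum A h d t" if "d \<in> S" for d t
  proof -
    have "line_sum A E d t = (\<Sum>z\<in>Z. (c z - X z) * line_sum A (F z) d t)"
      unfolding line_sum_eq_sum_offset E_def by (subst sum.swap) (simp add: sum_distrib_left)
    also have "\<dots> = 0"
      using line_sum_F_poly_translate[OF S(1,2) that] unfolding F_def A_def Z_def by simp
    finally show ?thesis by (simp add: f line_sum_diff h\<^sub>0)
  qed
  moreover have "L2_set (\<lambda>p. real_of_int (f p) - h p) A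
      \<le> 1 / 2 * sqrt (real_of_int (R_sum S * (int m - width S) * (int n - height S)))"
  proof -
    have "(\<Sum>p\<in>A. (real_of_int (f p) - h p)\<^sup>2) = (\<Sum>p\<in>A. (E p)\<^sup>2)"
      by (intro sum.cong) (auto simp: f h\<^sub>0_def)
    also have "\<dots> \<le> 1/4 * (\<Sum>z\<in>Z. \<Sum>p\<in>A. (F z p)\<^sup>2)"
      using X by (simp add: E_def)
    also have "\<dots> \<le> 1/4 * (\<Sum>z\<in>Z. real_of_int (R_sum S))"
      using sum_plane_coeff_squares_le
      by (intro mult_left_mono sum_mono) (auto simp: F_def A_def)
    \<comment> \<open>Validity makes both side lengths of \<open>Z\<close> positive, so the
      conversions by \<open>nat\<close> in its cardinality are exact.\<close>
    also have "\<dots> = (1/2)\<^sup>2 * real_of_int (R_sum S * (int m - width S) * (int n - height S))"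
      using S by (simp add: Z_def card_grid power2_eq_square)
    finally have "sqrt (\<Sum>p\<in>A. (real_of_int (f p) - h p)\<^sup>2)
        \<le> sqrt ((1/2)\<^sup>2 * real_of_int (R_sum S * (int m - width S) * (int n - height S)))"
      by (rule real_sqrt_le_mono)
    then show ?thesis by (simp only: L2_set_def real_sqrt_mult real_sqrt_abs)
  qed
  ultimately show ?thesis unfolding A_def by blast
qed

end
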